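(* There is a graph with treewidth $2$ and local queue number $3$.
   Context: Graphs are finite, simple and undirected. Given a linear ordering $\prec$ of the vertex set of a graph, two edges $uv$ and $xy$ nest if $u \prec x \prec y \prec v$ or $x \prec u \prec v \prec y$ (for the endpoints named suitably). A queue is a set of edges no two of which nest. A queue layout of $G$ consists of a linear ordering $\prec$ of $V(G)$ and a partition of $E(G)$ into queues; it is $\ell$-local if every vertex has incident edges in at most $\ell$ queues (the total number of queues being arbitrary). The local queue number of $G$ is the smallest $\ell$ such that $G$ has an $\ell$-local queue layout. *)

theory Defs
  imports Main "HOL-Library.Disjoint_Sets"
begin

definition simple_graph :: "'a set \<Rightarrow> 'a set set \<Rightarrow> bool" where
  "simple_graph V E \<longleftrightarrow> finite V \<and> (\<forall>e\<in>E. e \<subseteq> V \<and> card e = 2)"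

definition connected_graph :: "'a set \<Rightarrow> 'a set set \<Rightarrow> bool" where
  "connected_graph V E \<longleftrightarrow> V \<noteq> {} \<and> (\<forall>u\<in>V. \<forall>v\<in>V. (u, v) \<in> {(x, y). {x, y} \<in> E}\<^sup>*)"

definition is_cycle :: "'a set set \<Rightarrow> 'a list \<Rightarrow> bool" where
  "is_cycle E c \<longleftrightarrow> length c \<ge> 3 \<and> distinct c \<and>
     (\<forall>i<length c. {c ! i, c ! (Suc i mod length c)} \<in> E)"

definition tree_graph :: "'a set \<Rightarrow> 'a set set \<Rightarrow> bool" where
  "tree_graph V E \<longleftrightarrow> simple_graph V E \<and> connected_graph V E \<and> (\<nexists>c. is_cycle E c)"

definition tree_decomposition ::
  "'a set \<Rightarrow> 'a set set \<Rightarrow> 't set \<Rightarrow> 't set set \<Rightarrow> ('t \<Rightarrow> 'a set) \<Rightarrow> bool" where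
  "tree_decomposition V E T F bag \<longleftrightarrow>
     tree_graph T F \<and>
     (\<Union>t\<in>T. bag t) = V \<and>
     (\<forall>e\<in>E. \<exists>t\<in>T. e \<subseteq> bag t) \<and>
     (\<forall>v\<in>V. connected_graph {t\<in>T. v \<in> bag t} {f\<in>F. f \<subseteq> {t\<in>T. v \<in> bag t}})"

(* The subtraction truncates only for the graph without vertices, which gets width 0 instead of -1. *)
definition decomposition_width :: "'t set \<Rightarrow> ('t \<Rightarrow> 'a set) \<Rightarrow> nat" where
  "decomposition_width T bag = Max ((\<lambda>t. card (bag t)) ` T) - 1"

(* Decomposition trees are finite, so taking their nodes in nat loses no generality.
   A decomposition always exists for a finite graph (a single bag V), so LEAST is meaningful. *)
definition treewidth :: "'a set \<Rightarrow> 'a set set \<Rightarrow> nat" where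
  "treewidth V E =
     (LEAST k. \<exists>(T :: nat set) F bag. tree_decomposition V E T F bag \<and> decomposition_width T bag = k)"

definition nest :: "'a rel \<Rightarrow> 'a set \<Rightarrow> 'a set \<Rightarrow> bool" where
  "nest r e f \<longleftrightarrow> (\<exists>u v x y. e = {u, v} \<and> f = {x, y} \<and>
     ((u, x) \<in> r \<and> (x, y) \<in> r \<and> (y, v) \<in> r \<or>
      (x, u) \<in> r \<and> (u, v) \<in> r \<and> (v, y) \<in> r))"

definition is_queue :: "'a rel \<Rightarrow> 'a set set \<Rightarrow> bool" where
  "is_queue r Q \<longleftrightarrow> (\<forall>e\<in>Q. \<forall>f\<in>Q. \<not> nest r e f)"

definition queue_layout :: "'a set \<Rightarrow> 'a set set \<Rightarrow> 'a rel \<Rightarrow> 'a set set set \<Rightarrow> bool" where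
  "queue_layout V E r P \<longleftrightarrow>
     r \<subseteq> V \<times> V \<and> strict_linear_order_on V r \<and> partition_on E P \<and> (\<forall>Q\<in>P. is_queue r Q)"

definition local_layout :: "nat \<Rightarrow> 'a set \<Rightarrow> 'a set set set \<Rightarrow> bool" where
  "local_layout l V P \<longleftrightarrow> (\<forall>v\<in>V. card {Q\<in>P. \<exists>e\<in>Q. v \<in> e} \<le> l)"

(* For a finite graph, the partition of the edges into singletons is a queue layout for any
   vertex ordering, so LEAST is meaningful. *)
definition local_queue_number :: "'a set \<Rightarrow> 'a set set \<Rightarrow> nat" where
  "local_queue_number V E = (LEAST l. \<exists>r P. queue_layout V E r P \<and> local_layout l V P)"

end

theory Submission
  imports Defs
begin

text \<open>Take a 2-tree in which every edge, up to a large depth, has many common neighbours stacked onto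
  it. Its stars form a 3-local queue layout. Suppose there is a 2-local one. Since every vertex sees
  only two queues, many of the vertices \<open>w\<close> stacked onto an edge \<open>uv\<close> lie on the same
  side of \<open>u\<close> and \<open>v\<close> and have their edges \<open>uw\<close> in one queue \<open>a\<close> and \<open>vw\<close> in one queue \<open>b\<close>.

  If they lie to the right of \<open>u\<close> and \<open>v\<close>, then \<open>a \<noteq> b\<close>, so \<open>w\<close> sees exactly \<open>a\<close> and \<open>b\<close>, and all
  further neighbours of a middle one of the \<open>w\<close> are to the right as well. A case analysis forces the
  queue of every edge of a triangle to be determined by the two ends in a proper 3-colouring of the
  vertices, and then two edges in the same queue nest. The left side is symmetric.

  So almost all vertices stacked onto \<open>uv\<close> lie between \<open>u\<close> and \<open>v\<close>. Their edges are nested below \<open>uv\<close>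
  and below each other, which excludes first \<open>a \<noteq> b\<close> and then \<open>a = b\<close>.\<close>

subsection \<open>Edges with many stacked triangles\<close>

text \<open>A predicate on single edges: an argument can pass from \<open>uv\<close> to
  \<open>uw\<close> or \<open>vw\<close> at the cost of one level, without reference to how the
  whole graph was built.\<close>

primrec rich :: "('a \<Rightarrow> 'a \<Rightarrow> bool) \<Rightarrow> nat \<Rightarrow> nat \<Rightarrow> 'a \<Rightarrow> 'a \<Rightarrow> bool" where
  "rich adj n 0 u v \<longleftrightarrow> adj u v"
| "rich adj n (Suc k) u v \<longleftrightarrow>
     adj u v \<and> (\<exists>W. finite W \<and> card W = n \<and> (\<forall>w\<in>W. rich adj n k u w \<and> rich adj n k v w))"

lemma rich_adj: "rich adj n k u v \<Longrightarrow> adj u v"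
  by (cases k) auto

lemma rich_commute:
  assumes "\<And>u v. adj u v \<Longrightarrow> adj v u"
  shows "rich adj n k u v \<Longrightarrow> rich adj n k v u"
  by (cases k) (use assms in auto)

lemma rich_SucE:
  assumes "rich adj n (Suc k) u v"
  obtains W where "adj u v" "finite W" "card W = n"
    "\<And>w. w \<in> W \<Longrightarrow> rich adj n k u w" "\<And>w. w \<in> W \<Longrightarrow> rich adj n k v w"
  using assms by auto

lemma rich_SucI:
  assumes "adj u v" "finite W" "card W = n"
    "\<And>w. w \<in> W \<Longrightarrow> rich adj n k u w" "\<And>w. w \<in> W \<Longrightarrow> rich adj n k v w"
  shows "rich adj n (Suc k) u v"
  using assms by auto

lemma rich_Suc_imp: "rich adj n (Suc k) u v \<Longrightarrow> rich adj n k u v"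
proof (induction k arbitrary: u v)
  case (Suc k)
  from Suc.prems obtain W where W: "adj u v" "finite W" "card W = n"
    "\<And>w. w \<in> W \<Longrightarrow> rich adj n (Suc k) u w" "\<And>w. w \<in> W \<Longrightarrow> rich adj n (Suc k) v w"
    by (rule rich_SucE) (rule that)
  show ?case by (rule rich_SucI[where adj = adj, OF W(1-3)]) (rule Suc.IH, erule W)+
qed simp

lemma rich_le: "rich adj n k u v \<Longrightarrow> j \<le> k \<Longrightarrow> rich adj n j u v"
  by (induction k) (auto simp: le_Suc_eq simp del: rich.simps dest: rich_Suc_imp)

lemma rich_mono:
  assumes "\<And>u v. adj u v \<Longrightarrow> adj' u v"
  shows "rich adj n k u v \<Longrightarrow> rich adj' n k u v"
proof (induction k arbitrary: u v)
  case (Suc k)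
  from Suc.prems obtain W where W: "adj u v" "finite W" "card W = n"
    "\<And>w. w \<in> W \<Longrightarrow> rich adj n k u w" "\<And>w. w \<in> W \<Longrightarrow> rich adj n k v w"
    by (rule rich_SucE) (rule that)
  show ?case by (rule rich_SucI[where adj = adj', OF assms[OF W(1)] W(2,3)]) (rule Suc.IH, erule W)+
qed (use assms in simp)

section \<open>Pigeonhole and selection in vertex order\<close>

lemma large_fibre:
  assumes "finite W" "f ` W \<subseteq> T" "finite T" "card T * m < card W"
  shows "\<exists>t\<in>T. m < card {w\<in>W. f w = t}"
proof (rule ccontr)
  assume "\<not> ?thesis"
  then have small: "\<And>t. t \<in> T \<Longrightarrow> card {w\<in>W. f w = t} \<le> m" by auto
  have "W = (\<Union>t\<in>T. {w\<in>W. f w = t})" using assms(2) by auto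
  then have "card W \<le> (\<Sum>t\<in>T. card {w\<in>W. f w = t})"
    using card_UN_le[OF \<open>finite T\<close>, of "\<lambda>t. {w\<in>W. f w = t}"] by simp
  also have "\<dots> \<le> card T * m"
    using sum_bounded_above[of T _ m] small by simp
  finally show False using assms(4) by simp
qed

lemma increasing_quadruple:
  fixes f :: "'a \<Rightarrow> 'b::linorder"
  assumes "inj_on f W" "card W \<ge> 4"
  obtains w1 w2 w3 w4 where "{w1, w2, w3, w4} \<subseteq> W" "f w1 < f w2" "f w2 < f w3" "f w3 < f w4"
proof -
  have fin: "finite W" using assms(2) card.infinite by fastforce
  define l where "l = sorted_list_of_set (f ` W)"
  have l: "sorted_wrt (<) l" "set l = f ` W" "length l \<ge> 4"
    using assms fin by (auto simp: l_def card_image)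
  have "\<exists>w\<in>W. f w = l ! i" if "i < 4" for i
    using l that nth_mem[of i l] by force
  then obtain g where g: "\<And>i. i < 4 \<Longrightarrow> g i \<in> W \<and> f (g i) = l ! i"
    by metis
  have "l ! 0 < l ! 1" "l ! 1 < l ! 2" "l ! 2 < l ! 3"
    using l sorted_wrt_nth_less[OF l(1), of 0 1] sorted_wrt_nth_less[OF l(1), of 1 2]
      sorted_wrt_nth_less[OF l(1), of 2 3] by auto
  then show thesis
    using g by (intro that[of "g 0" "g 1" "g 2" "g 3"]) auto
qed

subsection \<open>Triangles stacked to the right of an edge\<close>

text \<open>Queues become colours of edges, and the vertex order becomes integer positions. Negating
  the positions reverses the order, so results about the right side carry over to the left.\<close>

locale two_local_layout =
  fixes adj :: "'a \<Rightarrow> 'a \<Rightarrow> bool" and col :: "'a \<Rightarrow> 'a \<Rightarrow> 'c" and pos :: "'a \<Rightarrow> int"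
  assumes adj_sym: "adj u v \<Longrightarrow> adj v u"
    and adj_irrefl: "\<not> adj u u"
    and col_sym: "col u v = col v u"
    and pos_inj: "inj_on pos {v. \<exists>w. adj v w}"
    and no_nest: "\<lbrakk>adj u v; adj x y; pos u < pos x; pos x < pos y; pos y < pos v\<rbrakk> \<Longrightarrow> col u v \<noteq> col x y"
    and two_colours: "\<lbrakk>adj v x; adj v y; adj v z; col v x \<noteq> col v y\<rbrakk> \<Longrightarrow> col v z \<in> {col v x, col v y}"
begin

abbreviation "colours v \<equiv> col v ` {w. adj v w}"

lemma mirror: "two_local_layout adj col (\<lambda>v. - pos v)"
proof
  show "inj_on (\<lambda>v. - pos v) {v. \<exists>w. adj v w}"
    using pos_inj by (auto simp: inj_on_def)
  show "col u v \<noteq> col x y" if "adj u v" "adj x y" "- pos u < - pos x" "- pos x < - pos y" "- pos y < - pos v" for u v x y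
    using no_nest[of v u y x] that adj_sym col_sym by (metis neg_less_iff_less)
qed (rule adj_sym adj_irrefl col_sym two_colours; assumption)+

lemma colours_subset: "\<lbrakk>adj v x; adj v y; col v x \<noteq> col v y\<rbrakk> \<Longrightarrow> colours v = {col v x, col v y}"
  using two_colours[of v x y] by auto

lemma colours_bounded: "finite (colours v) \<and> card (colours v) \<le> 2"
proof (cases "\<exists>x y. adj v x \<and> adj v y \<and> col v x \<noteq> col v y")
  case True
  then obtain x y where "adj v x" "adj v y" "col v x \<noteq> col v y" by blast
  from colours_subset[OF this] show ?thesis by (simp add: card_insert_if)
next
  case False
  then obtain p where sub: "colours v \<subseteq> {p}" by blast
  show ?thesis using finite_subset[OF sub] card_mono[OF _ sub] by simp
qed

lemma monochromatic_quadruple: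
  assumes W: "finite W" "card W \<ge> 13" and adj: "\<And>w. w \<in> W \<Longrightarrow> adj u w \<and> adj v w"
  obtains a b w1 w2 w3 w4 where "{w1, w2, w3, w4} \<subseteq> W"
    "pos w1 < pos w2" "pos w2 < pos w3" "pos w3 < pos w4"
    "\<And>w. w \<in> {w1, w2, w3, w4} \<Longrightarrow> col u w = a \<and> col v w = b"
proof -
  let ?f = "\<lambda>w. (col u w, col v w)" and ?T = "colours u \<times> colours v"
  have T: "finite ?T" "card ?T \<le> 2 * 2"
    using colours_bounded unfolding card_cartesian_product
    using mult_le_mono[of "card (colours u)" 2 "card (colours v)" 2] by auto
  have "?f ` W \<subseteq> ?T" using adj by auto
  moreover have "card ?T * 3 < card W" using T(2) W(2) by linarith
  ultimately obtain t where t: "3 < card {w\<in>W. ?f w = t}"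
    using large_fibre[OF W(1) _ T(1)] by blast
  have "inj_on pos {w\<in>W. ?f w = t}"
    using adj adj_sym by (intro inj_on_subset[OF pos_inj]) auto
  moreover from t have "4 \<le> card {w\<in>W. ?f w = t}" by simp
  ultimately obtain w1 w2 w3 w4 where
    w: "{w1, w2, w3, w4} \<subseteq> {w\<in>W. ?f w = t}" "pos w1 < pos w2" "pos w2 < pos w3" "pos w3 < pos w4"
    by (rule increasing_quadruple)
  show thesis
    by (rule that[of w1 w2 w3 w4 "fst t" "snd t"]) (use w in auto)
qed

text \<open>Of 37 = 3 * 12 + 1 vertices stacked onto an edge, 13 lie in the same of three positions, and of
  these 13 = 4 * 3 + 1 four agree in the queues of their two edges, as there are at most four pairs.\<close>

definition right_bundle where
  "right_bundle k u v a b w1 w2 w3 w4 \<longleftrightarrow> adj u v \<and>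
     pos u < pos v \<and> pos v < pos w1 \<and> pos w1 < pos w2 \<and> pos w2 < pos w3 \<and> pos w3 < pos w4 \<and>
     (\<forall>w\<in>{w1, w2, w3, w4}. rich adj 37 k u w \<and> rich adj 37 k v w \<and> col u w = a \<and> col v w = b)"

lemma right_bundleD:
  assumes "right_bundle k u v a b w1 w2 w3 w4"
  shows "adj u v" "pos u < pos v" "pos v < pos w1" "pos w1 < pos w2" "pos w2 < pos w3" "pos w3 < pos w4"
    "\<And>w. w \<in> {w1, w2, w3, w4} \<Longrightarrow> rich adj 37 k u w \<and> rich adj 37 k v w \<and>
      adj u w \<and> adj w u \<and> adj v w \<and> adj w v \<and> col u w = a \<and> col v w = b \<and> col w u = a \<and> col w v = b"
  using assms unfolding right_bundle_def by (blast | metis col_sym adj_sym rich_adj)+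

text \<open>Otherwise \<open>u w2\<close> would nest around \<open>v w1\<close> in one
  queue.\<close>

lemma right_bundle_neq:
  assumes "right_bundle k u v a b w1 w2 w3 w4"
  shows "a \<noteq> b"
proof -
  note R = right_bundleD[OF assms]
  show ?thesis using no_nest[of u w2 v w1] R by simp
qed

lemma right_bundle_colours:
  assumes "right_bundle k u v a b w1 w2 w3 w4" "w \<in> {w1, w2, w3, w4}"
  shows "colours w = {a, b}"
  using colours_subset[of w u v] right_bundle_neq[OF assms(1)] right_bundleD(7)[OF assms] by auto

text \<open>The edge \<open>wx\<close> shares its queue with all four edges from some
  \<open>z\<close> in \<open>{u, v}\<close> to the bundle. For any other position of
  \<open>x\<close> it would nest with the edge from \<open>z\<close> to \<open>w1\<close> or to
  \<open>w4\<close>.\<close>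

lemma right_bundle_neighbour:
  assumes "right_bundle k u v a b w1 w2 w3 w4" "w \<in> {w2, w3}" "adj w x" "x \<noteq> u" "x \<noteq> v"
  shows "pos w3 < pos x"
proof (rule ccontr)
  note R = right_bundleD[OF assms(1)]
  have w: "w \<in> {w1, w2, w3, w4}" using assms(2) by auto
  assume "\<not> pos w3 < pos x"
  have neq: "pos x \<noteq> pos u" "pos x \<noteq> pos v" "pos x \<noteq> pos w"
    using pos_inj assms(3-5) R(1) R(7)[OF w] adj_sym adj_irrefl unfolding inj_on_def by blast+
  have pw: "pos w1 < pos w" "pos w \<le> pos w3" "pos w < pos w4" "pos v < pos w"
    using assms(2) R(2-6) by auto
  have xw: "adj x w" "col x w = col w x" using assms(3) adj_sym col_sym by auto
  have "col w x \<in> {a, b}" using right_bundle_colours[OF assms(1) w] assms(3) by auto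
  then obtain z where z: "z \<in> {u, v}"
    "\<And>w'. w' \<in> {w1, w2, w3, w4} \<Longrightarrow> col z w' = col w x \<and> adj z w'"
    using R(7) by auto
  have zp: "pos z < pos w1" "pos z \<noteq> pos x" using z(1) R(2,3) neq by auto
  consider "pos x < pos z" | "pos z < pos x" "pos x < pos w" | "pos w < pos x" "pos x \<le> pos w3"
    using zp(2) neq(3) \<open>\<not> pos w3 < pos x\<close> by linarith
  then show False
  proof cases
    case 1
    then show False using no_nest[of x w z w1] z(2) xw zp pw by auto
  next
    case 2
    then show False using no_nest[of z w4 x w] z(2) xw pw by auto
  next
    case 3
    then show False using no_nest[of z w4 w x] z(2) assms(3) pw zp R(6) by auto
  qed
qed

lemma right_bundle_step_aux:
  assumes R: "right_bundle (Suc k) u v a b w1 w2 w3 w4" and w: "w \<in> {w2, w3}" and z: "z \<in> {u, v}"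
  obtains a' b' x1 x2 x3 x4 where "right_bundle k z w a' b' x1 x2 x3 x4"
    "\<And>x. x \<in> {x1, x2, x3, x4} \<Longrightarrow> pos w3 < pos x"
proof -
  note R' = right_bundleD[OF R]
  have "rich adj 37 (Suc k) z w" using R'(7)[of w] w z by auto
  then obtain W where W: "finite W" "card W = 37" "\<And>x. x \<in> W \<Longrightarrow> rich adj 37 k z x \<and> rich adj 37 k w x"
    by auto
  let ?W = "W - {u, v}"
  \<comment> \<open>Only \<open>u\<close> and \<open>v\<close> are removed from 37 vertices. All the
    others lie beyond \<open>w3\<close>, so no split by position is needed here.\<close>
  have c: "card ?W \<ge> 13" using diff_card_le_card_Diff[of "{u, v}" W] card_insert_le_m1[of 2 "{v}" u] W(2) by auto
  have far: "pos w3 < pos x" if "x \<in> ?W" for x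
    using right_bundle_neighbour[OF R w] W(3) that rich_adj by fastforce
  obtain a' b' x1 x2 x3 x4 where x: "{x1, x2, x3, x4} \<subseteq> ?W"
    "pos x1 < pos x2" "pos x2 < pos x3" "pos x3 < pos x4"
    "\<And>x. x \<in> {x1, x2, x3, x4} \<Longrightarrow> col z x = a' \<and> col w x = b'"
    using monochromatic_quadruple[of ?W z w] W c rich_adj by (metis Diff_iff finite_Diff)
  have zw: "adj z w" "pos w \<le> pos w3" "pos z < pos w"
    using w z R'(2-6) R'(7)[of w] by auto
  moreover have "pos w3 < pos x1" using far x(1) by auto
  with zw have "pos w < pos x1" by simp
  ultimately have "right_bundle k z w a' b' x1 x2 x3 x4"
    unfolding right_bundle_def
    using x(2-4) x(5) W(3) subsetD[OF x(1)] zw by (intro conjI ballI) simp_all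
  moreover have "pos w3 < pos x" if "x \<in> {x1,x2,x3,x4}" for x
    using far x(1) that by blast
  ultimately show thesis by (rule that)
qed

text \<open>The primed queues belong to the triangle stacked onto \<open>uw\<close>, the others to the one on \<open>vw\<close>.\<close>

lemma right_bundle_step:
  assumes "right_bundle (Suc k) u v a b w1 w2 w3 w4" "w \<in> {w2, w3}"
  obtains \<beta>' \<alpha>' y1 y2 y3 y4 \<beta> \<alpha> x1 x2 x3 x4 where
    "right_bundle k u w \<beta>' \<alpha>' y1 y2 y3 y4" "right_bundle k v w \<beta> \<alpha> x1 x2 x3 x4"
    "\<And>y. y \<in> {y1, y2, y3, y4} \<Longrightarrow> pos w3 < pos y"
    "\<And>x. x \<in> {x1, x2, x3, x4} \<Longrightarrow> pos w3 < pos x"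
    "\<beta>' \<in> colours u" "\<beta> \<in> colours v" "\<alpha>' \<in> {a, b}" "\<alpha> \<in> {a, b}" "\<beta> \<noteq> \<alpha>" "\<beta>' \<noteq> \<alpha>'" "\<beta>' \<noteq> b"
proof -
  have w: "w \<in> {w1, w2, w3, w4}" using assms(2) by auto
  note R = right_bundleD[OF assms(1)]
  obtain \<beta>' \<alpha>' y1 y2 y3 y4 where Y: "right_bundle k u w \<beta>' \<alpha>' y1 y2 y3 y4"
    "\<And>y. y \<in> {y1, y2, y3, y4} \<Longrightarrow> pos w3 < pos y"
    using right_bundle_step_aux[OF assms, of u] by blast
  obtain \<beta> \<alpha> x1 x2 x3 x4 where X: "right_bundle k v w \<beta> \<alpha> x1 x2 x3 x4"
    "\<And>x. x \<in> {x1, x2, x3, x4} \<Longrightarrow> pos w3 < pos x"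
    using right_bundle_step_aux[OF assms, of v] by blast
  note Y' = right_bundleD[OF Y(1)] and X' = right_bundleD[OF X(1)]
  have cw: "colours w = {a, b}" by (rule right_bundle_colours[OF assms(1) w])
  have "\<beta>' \<in> colours u" "\<alpha>' \<in> colours w" using Y'(7)[of y1] by auto
  moreover have "\<beta> \<in> colours v" "\<alpha> \<in> colours w" using X'(7)[of x1] by auto
  \<comment> \<open>The edge \<open>u y1\<close> passes over \<open>v w\<close>, which lies in
    \<open>b\<close>.\<close>
  moreover have "\<beta>' \<noteq> b"
    using no_nest[of u y1 v w] Y' R(7)[OF w] R(2) X'(2) by auto
  ultimately show thesis using that[OF Y(1) X(1) Y(2) X(2)] cw right_bundle_neq[OF X(1)] right_bundle_neq[OF Y(1)]
    by simp
qed

text \<open>For \<open>w2\<close> and for \<open>w3\<close> alike, the edges from \<open>u\<close>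
  and \<open>v\<close> to newly stacked vertices are forced into \<open>a\<close> and those from
  \<open>w2\<close> or \<open>w3\<close> into \<open>b\<close>. A vertex stacked at
  \<open>w2\<close> and two stacked at \<open>w3\<close> then give a nesting pair.\<close>

lemma right_bundle_two_coloured:
  assumes R: "right_bundle (Suc k) u v a b w1 w2 w3 w4"
    and "colours u \<subseteq> {a, b}" "colours v \<subseteq> {a, b}"
  shows False
proof -
  note R' = right_bundleD[OF R]
  have *: "\<exists>x y1 y2. pos y1 < pos y2 \<and> pos w3 < pos x \<and> pos w3 < pos y1 \<and>
      adj u y1 \<and> adj u y2 \<and> adj v x \<and> adj w y1 \<and> adj w y2 \<and> adj w x \<and>
      col u y1 = a \<and> col u y2 = a \<and> col v x = a \<and> col w y1 = b \<and> col w y2 = b \<and> col w x = b"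
    if w: "w \<in> {w2, w3}" for w
  proof -
    from right_bundle_step[OF R w] obtain \<beta>' \<alpha>' y1 y2 y3 y4 \<beta> \<alpha> x1 x2 x3 x4 where
      Y: "right_bundle k u w \<beta>' \<alpha>' y1 y2 y3 y4" and X: "right_bundle k v w \<beta> \<alpha> x1 x2 x3 x4"
      and far: "\<And>y. y \<in> {y1, y2, y3, y4} \<Longrightarrow> pos w3 < pos y"
      "\<And>x. x \<in> {x1, x2, x3, x4} \<Longrightarrow> pos w3 < pos x"
      and c: "\<beta>' \<in> colours u" "\<beta> \<in> colours v" "\<alpha>' \<in> {a, b}" "\<alpha> \<in> {a, b}" "\<beta> \<noteq> \<alpha>" "\<beta>' \<noteq> \<alpha>'" "\<beta>' \<noteq> b"
      by blast
    note Y' = right_bundleD[OF Y] and X' = right_bundleD[OF X]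
    have t: "\<beta>' = a" "\<alpha>' = b" using c assms(2) by auto
    \<comment> \<open>If \<open>y1\<close> precedes \<open>x2\<close>, then \<open>v x2\<close>
      passes over \<open>w y1\<close> in \<open>b\<close>; otherwise \<open>u y1\<close> passes over
      \<open>w x1\<close> in \<open>a\<close>.\<close>
    have "\<not> (\<beta> = b \<and> \<alpha> = a)"
    proof
      assume "\<beta> = b \<and> \<alpha> = a"
      then show False
        using no_nest[of v x2 w y1] no_nest[of u y1 w x2] no_nest[of v x1 w y1] no_nest[of u y1 w x1]
          X'(7)[of x1] X'(7)[of x2] Y'(7)[of y1] X' Y' t
        by (cases "pos y1 < pos x2") auto
    qed
    then have "\<beta> = a" "\<alpha> = b" using c(2,4,5) assms(3) by auto
    then show ?thesis
      using Y'(4) far(1)[of y1] far(2)[of x1] Y'(7)[of y1] Y'(7)[of y2] X'(7)[of x1] t by auto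
  qed
  obtain x where x: "pos w3 < pos x" "adj v x" "adj w2 x" "col v x = a" "col w2 x = b"
    using *[OF insertI1] by blast
  obtain y1 y2 where y: "pos y1 < pos y2" "pos w3 < pos y1" "adj u y2" "col u y2 = a" "adj w3 y1" "col w3 y1 = b"
    using *[of w3] by blast
  \<comment> \<open>Otherwise \<open>u y2\<close> nests around \<open>v x\<close> in
    \<open>a\<close>. So \<open>y1\<close> precedes \<open>x\<close>, and \<open>w2 x\<close> nests
    around \<open>w3 y1\<close> in \<open>b\<close>.\<close>
  have "pos y2 \<le> pos x" using no_nest[of u y2 v x] x y R' by force
  then have "pos y1 < pos x" using y(1) by simp
  then show False using no_nest[of w2 x w3 y1] x y R' by simp
qed

text \<open>If \<open>uv\<close> were in \<open>a\<close>, then \<open>v\<close> would see only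
  \<open>a\<close> and \<open>b\<close>, as \<open>w2\<close> does, and the bundle stacked onto
  \<open>v w2\<close> would contradict \<open>right_bundle_two_coloured\<close>. If
  \<open>uv\<close> were in \<open>b\<close>, the same would happen at \<open>u\<close>.\<close>

lemma right_bundle_base_neq:
  assumes R: "right_bundle (Suc (Suc k)) u v a b w1 w2 w3 w4"
  shows "col u v \<noteq> a" "col u v \<noteq> b"
proof -
  note R' = right_bundleD[OF R] and ab = right_bundle_neq[OF R]
  obtain \<beta>' \<alpha>' y1 y2 y3 y4 \<beta> \<alpha> x1 x2 x3 x4 where
      Y: "right_bundle (Suc k) u w2 \<beta>' \<alpha>' y1 y2 y3 y4" and X: "right_bundle (Suc k) v w2 \<beta> \<alpha> x1 x2 x3 x4"
      and c: "\<beta>' \<in> colours u" "\<beta> \<in> colours v" "\<alpha>' \<in> {a, b}" "\<alpha> \<in> {a, b}" "\<beta> \<noteq> \<alpha>" "\<beta>' \<noteq> \<alpha>'"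
    by (rule right_bundle_step[OF R, where w = w2]) (simp, rule that)
  have w: "colours w2 = {a, b}" using right_bundle_colours[OF R] by auto
  show "col u v \<noteq> a"
  proof
    assume "col u v = a"
    then have "colours v = {a, b}"
      using colours_subset[of v u w2] R' ab adj_sym col_sym by force
    then have "{\<beta>, \<alpha>} = {a, b}" using c by auto
    then show False
      using right_bundle_two_coloured[OF X] w \<open>colours v = {a, b}\<close> by simp
  qed
  show "col u v \<noteq> b"
  proof
    assume "col u v = b"
    then have "colours u = {a, b}"
      using colours_subset[of u w2 v] R' ab by force
    then have "{\<beta>', \<alpha>'} = {a, b}" using c by auto
    then show False
      using right_bundle_two_coloured[OF Y] w \<open>colours u = {a, b}\<close> by simp
  qed
qed

text \<open>Each of \<open>u\<close>, \<open>v\<close>, \<open>w2\<close> sees two of the three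
  queues \<open>a\<close>, \<open>b\<close>, \<open>col u v\<close> and misses a different one.
  \<open>right_bundle_base_neq\<close>, applied to the stacked bundles, bars the queue of their base
  edge and leaves one choice at each end.\<close>

lemma right_bundle_colour_pattern:
  assumes R: "right_bundle (Suc (Suc (Suc k))) u v a b w1 w2 w3 w4"
  obtains y1 y2 y3 y4 x1 x2 x3 x4 where
    "right_bundle (Suc (Suc k)) u w2 (col u v) b y1 y2 y3 y4"
    "right_bundle (Suc (Suc k)) v w2 (col u v) a x1 x2 x3 x4"
proof -
  note R' = right_bundleD[OF R]
  note Q = right_bundle_base_neq[OF R]
  obtain \<beta>' \<alpha>' y1 y2 y3 y4 \<beta> \<alpha> x1 x2 x3 x4 where
      Y: "right_bundle (Suc (Suc k)) u w2 \<beta>' \<alpha>' y1 y2 y3 y4"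
      and X: "right_bundle (Suc (Suc k)) v w2 \<beta> \<alpha> x1 x2 x3 x4"
      and c: "\<beta>' \<in> colours u" "\<beta> \<in> colours v" "\<alpha>' \<in> {a, b}" "\<alpha> \<in> {a, b}"
    by (rule right_bundle_step[OF R, where w = w2]) (simp, rule that)
  have cu: "colours u = {col u v, a}" and cv: "colours v = {col u v, b}"
    using colours_subset[of u v w2] colours_subset[of v u w2] R'(1) R'(7)[of w2] Q adj_sym[of u v] col_sym[of u v]
    by auto
  have "col u w2 = a" "col v w2 = b" using R'(7)[of w2] by auto
  then have "\<beta>' = col u v" "\<alpha>' = b" "\<beta> = col u v" "\<alpha> = a"
    using right_bundle_base_neq[OF X] right_bundle_base_neq[OF Y] c cu cv by auto
  then show thesis using that X Y by blast
qed

text \<open>The pattern needs three levels. It is used on \<open>uv\<close> and again on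
  \<open>v w2\<close>, one level down, hence the 4.\<close>

lemma no_right_bundle: "\<not> right_bundle 4 u v a b w1 w2 w3 w4"
proof
  assume "right_bundle 4 u v a b w1 w2 w3 w4"
  then have R: "right_bundle (Suc (Suc (Suc 1))) u v a b w1 w2 w3 w4" by (simp add: numeral_eq_Suc)
  note R' = right_bundleD[OF R]
  obtain y1 y2 y3 y4 x1 x2 x3 x4 where
    Y: "right_bundle (Suc (Suc 1)) u w2 (col u v) b y1 y2 y3 y4" and
    X: "right_bundle (Suc (Suc (Suc 0))) v w2 (col u v) a x1 x2 x3 x4"
    using right_bundle_colour_pattern[OF R] by (metis One_nat_def)
  note X' = right_bundleD[OF X] and Y' = right_bundleD[OF Y]
  obtain t1 t2 t3 t4 where T: "right_bundle (Suc (Suc 0)) v x2 (col v w2) a t1 t2 t3 t4"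
    using right_bundle_colour_pattern[OF X] by metis
  note T' = right_bundleD[OF T]
  \<comment> \<open>Both \<open>u y1\<close> and \<open>v x2\<close> lie in the queue of
    \<open>uv\<close>, so \<open>y1\<close> beyond \<open>x2\<close> would make them nest. Hence
    \<open>t1\<close> lies beyond \<open>y1\<close>, and \<open>v t1\<close> nests around
    \<open>w2 y1\<close> in \<open>b\<close>.\<close>
  have "pos y1 \<le> pos x2"
    using no_nest[of u y1 v x2] R'(2) X' Y' by force
  then have "pos y1 < pos t1" using T' by linarith
  then show False
    using no_nest[of v t1 w2 y1] T' Y' X'(2) R'(7)[of w2] by simp
qed

lemma few_right_children:
  assumes "adj u v" "pos u < pos v" "finite W" "\<And>w. w \<in> W \<Longrightarrow> pos v < pos w \<and> rich adj 37 4 u w \<and> rich adj 37 4 v w"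
  shows "card W < 13"
proof (rule ccontr)
  assume "\<not> card W < 13"
  then have "card W \<ge> 13" by simp
  moreover have "adj u w \<and> adj v w" if "w \<in> W" for w
    using assms(4)[OF that] rich_adj by metis
  ultimately obtain a b w1 w2 w3 w4 where w: "{w1, w2, w3, w4} \<subseteq> W"
    "pos w1 < pos w2" "pos w2 < pos w3" "pos w3 < pos w4"
    "\<And>w. w \<in> {w1, w2, w3, w4} \<Longrightarrow> col u w = a \<and> col v w = b"
    using monochromatic_quadruple[OF assms(3), of u v] by metis
  then have "right_bundle 4 u v a b w1 w2 w3 w4"
    unfolding right_bundle_def using assms(1,2) assms(4)[OF subsetD[OF w(1)]]
    by (intro conjI ballI) simp_all
  then show False using no_right_bundle by blast
qed

subsection \<open>Triangles stacked below an edge\<close>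

text \<open>The five extra levels are what is needed to exclude right and left bundles on the edges at \<open>w\<close>.\<close>

definition middle_bundle where
  "middle_bundle k u v a b w1 w2 w3 \<longleftrightarrow> adj u v \<and>
     pos u < pos w1 \<and> pos w1 < pos w2 \<and> pos w2 < pos w3 \<and> pos w3 < pos v \<and>
     (\<forall>w\<in>{w1, w2, w3}. rich adj 37 (k + 5) u w \<and> rich adj 37 (k + 5) v w \<and> col u w = a \<and> col v w = b)"

lemma middle_bundleD:
  assumes "middle_bundle k u v a b w1 w2 w3"
  shows "adj u v" "pos u < pos w1" "pos w1 < pos w2" "pos w2 < pos w3" "pos w3 < pos v"
    "\<And>w. w \<in> {w1, w2, w3} \<Longrightarrow> rich adj 37 (k + 5) u w \<and> rich adj 37 (k + 5) w v \<and>
      adj u w \<and> adj w u \<and> adj v w \<and> adj w v \<and> col u w = a \<and> col v w = b \<and> col w u = a \<and> col w v = b"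
proof -
  show "adj u v" "pos u < pos w1" "pos w1 < pos w2" "pos w2 < pos w3" "pos w3 < pos v"
    using assms unfolding middle_bundle_def by blast+
  fix w assume "w \<in> {w1, w2, w3}"
  then have w: "rich adj 37 (k + 5) u w" "rich adj 37 (k + 5) v w" "col u w = a" "col v w = b"
    using assms unfolding middle_bundle_def by blast+
  then show "rich adj 37 (k + 5) u w \<and> rich adj 37 (k + 5) w v \<and>
      adj u w \<and> adj w u \<and> adj v w \<and> adj w v \<and> col u w = a \<and> col v w = b \<and> col w u = a \<and> col w v = b"
    using rich_commute[of adj, OF adj_sym w(2)] rich_adj[OF w(1)] rich_adj[OF w(2)] adj_sym col_sym
    by metis
qed

text \<open>At most 12 of the 37 stacked vertices lie to the right and, by reversal, at most 12 to
  the left. The remaining 13 or more suffice for \<open>monochromatic_quadruple\<close>.\<close>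

lemma rich_middle_bundle:
  assumes rich: "rich adj 37 (Suc k + 5) u v" and uv: "pos u < pos v"
  obtains a b w1 w2 w3 where "middle_bundle k u v a b w1 w2 w3"
proof -
  interpret mirror: two_local_layout adj col "\<lambda>v. - pos v" by (rule mirror)
  obtain W where W: "adj u v" "finite W" "card W = 37"
    "\<And>w. w \<in> W \<Longrightarrow> rich adj 37 (k + 5) u w" "\<And>w. w \<in> W \<Longrightarrow> rich adj 37 (k + 5) v w"
    using rich unfolding add_Suc by (rule rich_SucE) (rule that)
  have W4: "rich adj 37 4 u w \<and> rich adj 37 4 v w" if "w \<in> W" for w
    using rich_le[OF W(4)[OF that], of 4] rich_le[OF W(5)[OF that], of 4] by simp
  define R L M where "R = {w\<in>W. pos v < pos w}" and "L = {w\<in>W. pos w < pos u}"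
    and "M = {w\<in>W. pos u < pos w \<and> pos w < pos v}"
  have fin: "finite R" "finite L" "finite M" using W(2) by (auto simp: R_def L_def M_def)
  have "card R < 13"
    using W4 by (intro few_right_children[OF W(1) uv fin(1)]) (auto simp: R_def)
  moreover have "card L < 13"
    using W4 uv by (intro mirror.few_right_children[OF adj_sym[OF W(1)] _ fin(2)]) (auto simp: L_def)
  moreover have "W = R \<union> L \<union> M"
  proof -
    have "pos w \<noteq> pos u" "pos w \<noteq> pos v" if "w \<in> W" for w
      using pos_inj rich_adj[OF W(4)[OF that]] rich_adj[OF W(5)[OF that]] adj_sym adj_irrefl
      unfolding inj_on_def by blast+
    then show ?thesis unfolding R_def L_def M_def by force
  qed
  then have "card W \<le> card R + card L + card M"
    using card_Un_le[of "R \<union> L" M] card_Un_le[of R L] by simp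
  ultimately have "card M \<ge> 13" using W(3) by linarith
  moreover have "adj u w \<and> adj v w" if "w \<in> M" for w
    using rich_adj[OF W(4)] rich_adj[OF W(5)] that unfolding M_def by simp
  ultimately obtain a b w1 w2 w3 w4 where w: "{w1, w2, w3, w4} \<subseteq> M"
    "pos w1 < pos w2" "pos w2 < pos w3" "pos w3 < pos w4"
    "\<And>w. w \<in> {w1, w2, w3, w4} \<Longrightarrow> col u w = a \<and> col v w = b"
    by (rule monochromatic_quadruple[OF fin(3), of u v]) (assumption, rule that)
  have "pos u < pos w1" "pos w3 < pos v" using w(1) unfolding M_def by auto
  moreover have "w \<in> W" if "w \<in> {w1, w2, w3, w4}" for w using w(1) that unfolding M_def by auto
  ultimately have "middle_bundle k u v a b w1 w2 w3"
    unfolding middle_bundle_def using W(1,4,5) w(2,3,5) by auto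
  then show thesis by (rule that)
qed

lemma middle_bundle_colours:
  assumes "middle_bundle k u v a b w1 w2 w3" "a \<noteq> b" "w \<in> {w1, w2, w3}"
  shows "colours w = {a, b}"
  using colours_subset[of w u v] assms(2) middle_bundleD(6)[OF assms(1,3)] by auto

text \<open>An edge at \<open>w2\<close> that stays between \<open>u\<close> and \<open>v\<close> is
  nested below \<open>uv\<close> and below \<open>u w3\<close> or \<open>w1 v\<close>. This is why a
  bundle has a vertex on each side of \<open>w2\<close>.\<close>

lemma middle_bundle_between:
  assumes M: "middle_bundle k u v a b w1 w2 w3" and x: "adj w2 x"
  shows "\<lbrakk>pos u < pos x; pos x < pos w2\<rbrakk> \<Longrightarrow> col w2 x \<noteq> a"
    "\<lbrakk>pos w2 < pos x; pos x < pos v\<rbrakk> \<Longrightarrow> col w2 x \<noteq> b"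
    "\<lbrakk>pos u < pos x; pos x < pos v\<rbrakk> \<Longrightarrow> col w2 x \<noteq> col u v"
proof -
  note M' = middle_bundleD[OF M]
  have neq: "pos x \<noteq> pos w2"
    using pos_inj x adj_sym adj_irrefl unfolding inj_on_def by blast
  note xs = adj_sym[OF x] col_sym[of x w2]
  show "\<lbrakk>pos u < pos x; pos x < pos w2\<rbrakk> \<Longrightarrow> col w2 x \<noteq> a"
    using no_nest[of u w3 x w2] M' xs by auto
  show "\<lbrakk>pos w2 < pos x; pos x < pos v\<rbrakk> \<Longrightarrow> col w2 x \<noteq> b"
    using no_nest[of w1 v w2 x] M' x by auto
  show "\<lbrakk>pos u < pos x; pos x < pos v\<rbrakk> \<Longrightarrow> col w2 x \<noteq> col u v"
    using no_nest[of u v w2 x] no_nest[of u v x w2] M' x xs neq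
    by (cases "pos x < pos w2") auto
qed

text \<open>The bundle found on \<open>u w2\<close> stays between \<open>u\<close> and
  \<open>v\<close>, so \<open>middle_bundle_between\<close> restricts its queue at
  \<open>w2\<close>.\<close>

lemma middle_bundle_left:
  assumes M: "middle_bundle (Suc k) u v a b w1 w2 w3"
  obtains e d x1 x2 x3 where "middle_bundle k u w2 e d x1 x2 x3" "e \<in> colours u" "d \<in> colours w2"
    "d \<noteq> a" "d \<noteq> col u v"
proof -
  note M' = middle_bundleD[OF M]
  have "rich adj 37 (Suc k + 5) u w2" "pos u < pos w2" using M' by auto
  then obtain e d x1 x2 x3 where X: "middle_bundle k u w2 e d x1 x2 x3"
    using rich_middle_bundle by blast
  note X' = middle_bundleD[OF X]
  show thesis
    using X'(6)[of x2] X'(2-5) M'(2-5) middle_bundle_between(1,3)[OF M, of x2]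
    by (intro that[OF X]) force+
qed

lemma middle_bundle_right:
  assumes M: "middle_bundle (Suc k) u v a b w1 w2 w3"
  obtains e d x1 x2 x3 where "middle_bundle k w2 v e d x1 x2 x3" "e \<in> colours w2"
    "e \<noteq> b" "e \<noteq> col u v"
proof -
  note M' = middle_bundleD[OF M]
  have "rich adj 37 (Suc k + 5) w2 v" "pos w2 < pos v" using M' by auto
  then obtain e d x1 x2 x3 where X: "middle_bundle k w2 v e d x1 x2 x3"
    using rich_middle_bundle by blast
  note X' = middle_bundleD[OF X]
  show thesis
    using X'(6)[of x2] X'(2-5) M'(2-5) middle_bundle_between(2,3)[OF M, of x2]
    by (intro that[OF X]) force+
qed

text \<open>Since \<open>w2\<close> sees only \<open>a\<close> and \<open>b\<close>, the bundle on
  \<open>u w2\<close> uses \<open>b\<close> at \<open>w2\<close> and the one on \<open>w2 v\<close>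
  uses \<open>a\<close>. Neither may be the queue of \<open>uv\<close>.\<close>

lemma middle_bundle_base_neq:
  assumes M: "middle_bundle (Suc k) u v a b w1 w2 w3" and ab: "a \<noteq> b"
  shows "col u v \<noteq> a" "col u v \<noteq> b"
proof -
  have w: "colours w2 = {a, b}" using middle_bundle_colours[OF M ab] by simp
  obtain d where "d \<in> colours w2" "d \<noteq> a" "d \<noteq> col u v"
    using M by (rule middle_bundle_left)
  then show "col u v \<noteq> b" using w by auto
  obtain e where "e \<in> colours w2" "e \<noteq> b" "e \<noteq> col u v"
    using M by (rule middle_bundle_right)
  then show "col u v \<noteq> a" using w by auto
qed

text \<open>If \<open>a\<close> and \<open>b\<close> differ, the bundle on \<open>u w2\<close>
  yields a vertex \<open>x2\<close> that sees only \<open>b\<close> and the queue of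
  \<open>uv\<close>. Its edges to the right that end before \<open>v\<close> are nested below
  \<open>uv\<close>, hence lie in \<open>b\<close>, and two further bundles below
  \<open>x2 w2\<close> give a nesting pair in \<open>b\<close>. Three descents and the successor in
  \<open>middle_bundle_base_neq\<close> account for the 4.\<close>

lemma middle_bundle_eq:
  assumes M: "middle_bundle (k + 4) u v a b w1 w2 w3"
  shows "a = b"
proof (rule ccontr)
  assume ab: "a \<noteq> b"
  have M1: "middle_bundle (Suc (k + 3)) u v a b w1 w2 w3" using M by (simp add: numeral_eq_Suc)
  note M' = middle_bundleD[OF M]
  note Q = middle_bundle_base_neq[OF M1 ab]
  have cu: "colours u = {col u v, a}"
    using colours_subset[of u v w2] M'(1) M'(6)[of w2] Q by auto
  have cw: "colours w2 = {a, b}" using middle_bundle_colours[OF M ab] by simp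
  obtain e d x1 x2 x3 where X: "middle_bundle (k + 3) u w2 e d x1 x2 x3"
    and ed: "e \<in> colours u" "d \<in> colours w2" "d \<noteq> a" "d \<noteq> col u v"
    using M1 by (rule middle_bundle_left)
  note X' = middle_bundleD[OF X]
  have X1: "middle_bundle (Suc (k + 2)) u w2 e d x1 x2 x3" using X by (simp add: numeral_eq_Suc)
  have d: "d = b" using ed cw by auto
  have "e \<noteq> d" using ed cu d ab Q by auto
  then have "e \<noteq> a" using middle_bundle_base_neq[OF X1] M'(6)[of w2] by auto
  then have e: "e = col u v" using ed(1) cu by auto
  have cx: "colours x2 = {col u v, b}"
    using middle_bundle_colours[OF X \<open>e \<noteq> d\<close>] e d by simp
  have ux: "pos u < pos x2" "pos x2 < pos w2" "pos w2 < pos v" using X' M' by auto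
  have col_b: "col x2 y = b" if "adj x2 y" "pos x2 < pos y" "pos y < pos v" for y
    using no_nest[of u v x2 y] M'(1) imageI[of y "{w. adj x2 w}" "col x2"] that ux unfolding cx by auto
  have col_w: "col y w2 = b" if "adj w2 y" "pos u < pos y" "pos y < pos w2" for y
    using middle_bundle_between(1)[OF M that] cw that(1) col_sym[of y w2] by auto
  have "rich adj 37 (Suc (k + 2) + 5) x2 w2" using X'(6)[of x2] by (simp add: numeral_eq_Suc)
  then obtain f g t1 t2 t3 where T: "middle_bundle (k + 2) x2 w2 f g t1 t2 t3"
    using ux(2) by (rule rich_middle_bundle)
  note T' = middle_bundleD[OF T]
  have "rich adj 37 (Suc (k + 1) + 5) x2 t2" "pos x2 < pos t2" using T' by auto
  then obtain h i s1 s2 s3 where S: "middle_bundle (k + 1) x2 t2 h i s1 s2 s3"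
    by (rule rich_middle_bundle)
  note S' = middle_bundleD[OF S]
  have "col x2 t2 = b" using col_b[of t2] T'(2-5) T'(6)[of t2] ux by auto
  moreover have h: "h = b" using col_b[of s2] S'(2-5) S'(6)[of s2] T'(2-5) ux by auto
  \<comment> \<open>Otherwise \<open>h\<close> and \<open>i\<close> differ, and
    \<open>middle_bundle_base_neq\<close> keeps \<open>x2 t2\<close> out of \<open>h\<close>,
    although both are \<open>b\<close>. Now \<open>s2 t2\<close> lies in \<open>b\<close> below
    \<open>x2 w2\<close>.\<close>
  ultimately have "i = b" using middle_bundle_base_neq(1)[of k x2 t2 h i s1 s2 s3] S by auto
  then show False
    using no_nest[of x2 w2 s2 t2] S'(2-5) S'(6)[of s2] T'(1-5) col_b[of w2] ux by auto
qed

text \<open>The bundle on \<open>u w2\<close> has a single queue, different from \<open>a\<close>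
  and from \<open>col u v\<close>. As \<open>u\<close> sees all three but at most two queues, the
  latter two coincide.\<close>

lemma middle_bundle_all_eq:
  assumes M: "middle_bundle (k + 5) u v a b w1 w2 w3"
  shows "a = b" "col u v = a"
proof -
  have M1: "middle_bundle (k + 1 + 4) u v a b w1 w2 w3" "middle_bundle (Suc (k + 4)) u v a b w1 w2 w3"
    using M by (simp_all add: numeral_eq_Suc)
  show "a = b" by (rule middle_bundle_eq[OF M1(1)])
  obtain e d x1 x2 x3 where X: "middle_bundle (k + 4) u w2 e d x1 x2 x3"
    and ed: "e \<in> colours u" "d \<noteq> a" "d \<noteq> col u v"
    using M1(2) by (rule middle_bundle_left)
  have "e = d" by (rule middle_bundle_eq[OF X])
  then show "col u v = a"
    using colours_subset[of u v w2] middle_bundleD(1,6)[OF M] ed by fastforce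
qed

lemma not_rich:
  assumes "pos u \<noteq> pos v"
  shows "\<not> rich adj 37 12 u v"
proof
  assume rich: "rich adj 37 12 u v"
  obtain x y where "rich adj 37 12 x y" "pos x < pos y"
    using assms rich rich_commute[of adj, OF adj_sym rich] by (metis neqE)
  \<comment> \<open>The 12 levels: one to find the bundle on \<open>xy\<close>, one to pass to
    \<open>x w2\<close>, five for \<open>middle_bundle_all_eq\<close> and the five extra ones in
    \<open>middle_bundle\<close>. On \<open>x w2\<close> all queues equal \<open>a\<close>, although
    \<open>d\<close> differs from \<open>a\<close>.\<close>
  then have "rich adj 37 (Suc 6 + 5) x y" "pos x < pos y" by simp_all
  then obtain a b w1 w2 w3 where M: "middle_bundle 6 x y a b w1 w2 w3"
    by (rule rich_middle_bundle)
  then have "middle_bundle (Suc (0 + 5)) x y a b w1 w2 w3" by simp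
  then obtain e d x1 x2 x3 where X: "middle_bundle (0 + 5) x w2 e d x1 x2 x3" "d \<noteq> a"
    by (rule middle_bundle_left)
  show False
    using middle_bundle_all_eq[OF X(1)] X(2) middle_bundleD(6)[OF M, of w2] by simp
qed

end

subsection \<open>Two-trees\<close>

inductive two_tree :: "'a set \<Rightarrow> 'a set set \<Rightarrow> bool" where
  edge: "u \<noteq> v \<Longrightarrow> two_tree {u, v} {{u, v}}"
| stack: "\<lbrakk>two_tree V E; {u, v} \<in> E; w \<notin> V\<rbrakk> \<Longrightarrow> two_tree (insert w V) (insert {u, w} (insert {v, w} E))"

lemma two_tree_simple: "two_tree V E \<Longrightarrow> simple_graph V E"
proof (induction rule: two_tree.induct)
  case (stack V E u v w)
  then have "u \<in> V" "v \<in> V" "finite V" "\<And>e. e \<in> E \<Longrightarrow> e \<subseteq> V \<and> card e = 2"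
    unfolding simple_graph_def by auto
  moreover from this have "u \<noteq> w" "v \<noteq> w" using stack by auto
  ultimately show ?case unfolding simple_graph_def by (auto simp: card_insert_if)
qed (auto simp: simple_graph_def)

text \<open>The inner induction stacks one fresh natural number at a time onto \<open>uv\<close> and
  makes its two edges rich by the outer hypothesis; \<open>rich_mono\<close> preserves what was
  reached before.\<close>

lemma two_tree_rich_extension:
  fixes V :: "nat set"
  assumes "two_tree V E" "{u, v} \<in> E"
  shows "\<exists>V' E'. two_tree V' E' \<and> V \<subseteq> V' \<and> E \<subseteq> E' \<and> rich (\<lambda>x y. {x, y} \<in> E') n k u v"
  using assms
proof (induction k arbitrary: V E u v)
  case 0
  then show ?case by (intro exI[of _ V] exI[of _ E]) simp
next
  case (Suc k)
  note IH = Suc.IH and uv = Suc.prems(2)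
  have "\<exists>V' E' W. two_tree V' E' \<and> V \<subseteq> V' \<and> E \<subseteq> E' \<and> finite W \<and> card W = m \<and> W \<subseteq> V' \<and>
      (\<forall>w\<in>W. rich (\<lambda>x y. {x, y} \<in> E') n k u w \<and> rich (\<lambda>x y. {x, y} \<in> E') n k v w)" for m
  proof (induction m)
    case 0
    show ?case using Suc.prems by (intro exI[of _ V] exI[of _ E] exI[of _ "{}"]) simp
  next
    case (Suc m)
    then obtain V1 E1 W where 1: "two_tree V1 E1" "V \<subseteq> V1" "E \<subseteq> E1" "finite W" "card W = m" "W \<subseteq> V1"
      "\<And>w. w \<in> W \<Longrightarrow> rich (\<lambda>x y. {x, y} \<in> E1) n k u w \<and> rich (\<lambda>x y. {x, y} \<in> E1) n k v w"
      by blast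
    obtain w where w: "w \<notin> V1"
      using two_tree_simple[OF 1(1)] ex_new_if_finite infinite_UNIV_nat unfolding simple_graph_def by blast
    let ?E = "insert {u, w} (insert {v, w} E1)"
    have "two_tree (insert w V1) ?E" by (rule two_tree.stack[OF 1(1) _ w]) (use uv 1(3) in blast)
    from IH[OF this, of u w] obtain V2 E2 where 2: "two_tree V2 E2" "insert w V1 \<subseteq> V2" "?E \<subseteq> E2"
      "rich (\<lambda>x y. {x, y} \<in> E2) n k u w" by blast
    from IH[OF 2(1), of v w] 2(3) obtain V3 E3 where 3: "two_tree V3 E3" "V2 \<subseteq> V3" "E2 \<subseteq> E3"
      "rich (\<lambda>x y. {x, y} \<in> E3) n k v w" by blast
    have E13: "E1 \<subseteq> E3" using 2(3) 3(3) by blast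
    have "rich (\<lambda>x y. {x, y} \<in> E3) n k u w" by (rule rich_mono[OF _ 2(4)]) (use 3(3) in blast)
    moreover have "rich (\<lambda>x y. {x, y} \<in> E3) n k u x \<and> rich (\<lambda>x y. {x, y} \<in> E3) n k v x" if "x \<in> W" for x
      using 1(7)[OF that] E13
        rich_mono[of "\<lambda>x y. {x, y} \<in> E1" "\<lambda>x y. {x, y} \<in> E3"] by blast
    moreover have "w \<notin> W" using 1(6) w by blast
    ultimately show ?case
      using 1(2-6) 2(2) 3 E13
      by (intro exI[of _ V3] exI[of _ E3] exI[of _ "insert w W"] conjI) auto
  qed
  then obtain V' E' W where "two_tree V' E'" "V \<subseteq> V'" "E \<subseteq> E'" "finite W" "card W = n"
    "\<forall>w\<in>W. rich (\<lambda>x y. {x, y} \<in> E') n k u w \<and> rich (\<lambda>x y. {x, y} \<in> E') n k v w" by meson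
  then show ?case using uv by (intro exI[of _ V'] exI[of _ E'] conjI rich_SucI[where W = W]) auto
qed

subsection \<open>Treewidth\<close>

lemma connected_graph_mono:
  assumes "connected_graph V E" "E \<subseteq> E'"
  shows "connected_graph V E'"
proof -
  have "{(x, y). {x, y} \<in> E}\<^sup>* \<subseteq> {(x, y). {x, y} \<in> E'}\<^sup>*"
    using assms(2) by (intro rtrancl_mono) auto
  then show ?thesis using assms(1) unfolding connected_graph_def by blast
qed

lemma connected_graph_singleton: "connected_graph {v} E"
  unfolding connected_graph_def by simp

lemma connected_graph_pendant:
  assumes "connected_graph V E" "u \<in> V"
  shows "connected_graph (insert w V) (insert {u, w} E)"
proof -
  let ?R = "{(x, y). {x, y} \<in> insert {u, w} E}"
  have old: "(x, y) \<in> ?R\<^sup>*" if "x \<in> V" "y \<in> V" for x y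
    using connected_graph_mono[OF assms(1), of "insert {u, w} E"] that
    unfolding connected_graph_def by blast
  have "(u, w) \<in> ?R\<^sup>*" "(w, u) \<in> ?R\<^sup>*" by (auto intro!: r_into_rtrancl simp: insert_commute)
  then have "(x, u) \<in> ?R\<^sup>*" "(u, x) \<in> ?R\<^sup>*" if "x \<in> insert w V" for x
    using old assms(2) that by auto
  then show ?thesis unfolding connected_graph_def by (meson insert_not_empty rtrancl_trans)
qed

text \<open>A cycle through \<open>w\<close> would contain two different neighbours of
  \<open>w\<close>, but \<open>u\<close> is the only one.\<close>

lemma tree_graph_pendant:
  assumes T: "tree_graph V E" and u: "u \<in> V" and w: "w \<notin> V"
  shows "tree_graph (insert w V) (insert {u, w} E)"
proof -
  let ?E = "insert {u, w} E"
  have simple: "simple_graph V E" and "connected_graph V E" and acyclic: "\<nexists>c. is_cycle E c"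
    using T unfolding tree_graph_def by blast+
  have only: "x = u" if "{w, x} \<in> ?E" for x
    using that simple w unfolding simple_graph_def by (auto simp: doubleton_eq_iff)
  have "\<not> is_cycle ?E c" for c
  proof
    assume "is_cycle ?E c"
    then have c: "length c \<ge> 3" "distinct c" "\<And>i. i < length c \<Longrightarrow> {c ! i, c ! (Suc i mod length c)} \<in> ?E"
      unfolding is_cycle_def by auto
    show False
    proof (cases "w \<in> set c")
      case False
      have "{c ! i, c ! (Suc i mod length c)} \<in> E" if "i < length c" for i
      proof -
        have "Suc i mod length c < length c" using c(1) by (intro mod_less_divisor) linarith
        then have "w \<notin> {c ! i, c ! (Suc i mod length c)}" using False that by (metis insertE nth_mem singletonD)
        then show ?thesis using c(3)[OF that] by blast
      qed
      then show False using acyclic c(1,2) unfolding is_cycle_def by blast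
    next
      case True
      then obtain i where i: "i < length c" "c ! i = w" by (metis in_set_conv_nth)
      define n where "n = length c"
      \<comment> \<open>The cyclic predecessor of \<open>i\<close>; it differs from the successor
        because the cycle has length at least 3.\<close>
      define j where "j = (if i = 0 then n - 1 else i - 1)"
      have j: "j < n" "Suc j mod n = i" using i c(1) by (auto simp: j_def n_def)
      have succ: "Suc i mod n < n" "Suc i mod n \<noteq> j"
        using i c(1) by (auto simp: j_def n_def mod_Suc)
      have "c ! (Suc i mod n) = u" using c(3)[OF i(1)] only i(2) by (simp add: n_def)
      moreover have "c ! j = u" using c(3)[of j] only i(2) j by (simp add: n_def insert_commute)
      ultimately show False using succ j(1) c(2) unfolding n_def distinct_conv_nth by metis
    qed
  qed
  moreover have "simple_graph (insert w V) ?E"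
    using simple u w unfolding simple_graph_def by (auto simp: card_insert_if)
  ultimately show ?thesis
    using connected_graph_pendant[OF \<open>connected_graph V E\<close> u, of w] unfolding tree_graph_def by simp
qed

text \<open>Each stacked vertex \<open>w\<close> brings a new leaf with bag
  \<open>{u, v, w}\<close>, attached to a node whose bag contains \<open>u\<close> and
  \<open>v\<close>. The subtrees of \<open>u\<close> and \<open>v\<close> grow by this leaf, and
  that of \<open>w\<close> is the leaf alone.\<close>

lemma two_tree_decomposition:
  assumes "two_tree V E"
  shows "\<exists>(T :: nat set) F bag. tree_decomposition V E T F bag \<and> (\<forall>t\<in>T. card (bag t) \<le> 3)"
  using assms
proof (induction rule: two_tree.induct)
  case (edge u v)
  have "tree_graph {0::nat} {}"
    by (auto simp: tree_graph_def simple_graph_def connected_graph_def is_cycle_def intro!: exI[of _ 0])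
  then have "tree_decomposition {u, v} {{u, v}} {0::nat} {} (\<lambda>_. {u, v})"
    unfolding tree_decomposition_def by (auto simp: connected_graph_singleton)
  then show ?case using edge by fastforce
next
  case (stack V E u v w)
  then obtain T :: "nat set" and F bag where D: "tree_decomposition V E T F bag" and
    small: "\<And>t. t \<in> T \<Longrightarrow> card (bag t) \<le> 3" by blast
  then have T: "tree_graph T F" and V: "(\<Union>t\<in>T. bag t) = V" and E: "\<And>e. e \<in> E \<Longrightarrow> \<exists>t\<in>T. e \<subseteq> bag t"
    and conn: "\<And>x. x \<in> V \<Longrightarrow> connected_graph {t\<in>T. x \<in> bag t} {f\<in>F. f \<subseteq> {t\<in>T. x \<in> bag t}}"
    unfolding tree_decomposition_def by blast+
  obtain t0 where t0: "t0 \<in> T" "{u, v} \<subseteq> bag t0" using E stack.hyps by blast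
  have "finite T" using T unfolding tree_graph_def simple_graph_def by blast
  then obtain t where t: "t \<notin> T" using ex_new_if_finite infinite_UNIV_nat by blast
  let ?T = "insert t T" and ?F = "insert {t0, t} F" and ?bag = "bag(t := {u, v, w})"
  have uv: "u \<in> V" "v \<in> V" using t0 V by auto
  have old: "?bag s = bag s" if "s \<in> T" for s using that t by auto
  have "connected_graph {s\<in>?T. x \<in> ?bag s} {f\<in>?F. f \<subseteq> {s\<in>?T. x \<in> ?bag s}}" if x: "x \<in> insert w V" for x
  proof -
    consider "x = w" | "x \<in> {u, v}" | "x \<in> V" "x \<notin> {u, v, w}" using x by blast
    then show ?thesis
    proof cases
      case 1
      then have "{s\<in>?T. x \<in> ?bag s} = {t}" using V stack.hyps old by auto
      then show ?thesis by (simp add: connected_graph_singleton)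
    next
      case 2
      let ?S = "{s\<in>T. x \<in> bag s}"
      have S: "{s\<in>?T. x \<in> ?bag s} = insert t ?S" using 2 t old by auto
      have "x \<in> V" "t0 \<in> ?S" using 2 uv t0 by auto
      from connected_graph_pendant[OF conn[OF this(1)] this(2), of t]
      show ?thesis unfolding S by (rule connected_graph_mono) (use t0 2 in auto)
    next
      case 3
      then have S: "{s\<in>?T. x \<in> ?bag s} = {s\<in>T. x \<in> bag s}" using t old by auto
      show ?thesis unfolding S by (rule connected_graph_mono[OF conn[OF 3(1)]]) auto
    qed
  qed
  moreover have "tree_graph ?T ?F" by (rule tree_graph_pendant[OF T t0(1) t])
  moreover have "(\<Union>s\<in>T. ?bag s) = (\<Union>s\<in>T. bag s)" using old by (rule SUP_cong[OF refl])
  then have "(\<Union>s\<in>?T. ?bag s) = insert w V" using uv V unfolding UN_insert by auto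
  moreover have "\<exists>s\<in>?T. e \<subseteq> ?bag s" if "e \<in> insert {u, w} (insert {v, w} E)" for e
  proof (cases "e \<in> E")
    case True
    then show ?thesis using E old by (metis insertI2)
  next
    case False
    then show ?thesis using that by auto
  qed
  ultimately have "tree_decomposition (insert w V) (insert {u, w} (insert {v, w} E)) ?T ?F ?bag"
    unfolding tree_decomposition_def by blast
  moreover have "card (?bag s) \<le> 3" if "s \<in> ?T" for s
    using that small by (auto simp: card_insert_if)
  ultimately show ?case by blast
qed

section \<open>Triangles in tree decompositions and the lower bound\<close>

lemma rtrancl_distinct_path:
  assumes "(x, y) \<in> R\<^sup>*"
  shows "\<exists>p. p \<noteq> [] \<and> hd p = x \<and> last p = y \<and> distinct p \<and> successively (\<lambda>a b. (a, b) \<in> R) p"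
  using assms
proof (induction rule: rtrancl_induct)
  case base
  show ?case by (rule exI[of _ "[x]"]) simp
next
  case (step y z)
  then obtain p where p: "p \<noteq> []" "hd p = x" "last p = y" "distinct p" "successively (\<lambda>a b. (a, b) \<in> R) p"
    by blast
  show ?case
  proof (cases "z \<in> set p")
    case True
    then obtain as bs where "p = as @ z # bs" by (metis split_list)
    then show ?thesis using p
      by (intro exI[of _ "as @ [z]"]) (auto simp: successively_append_iff hd_append)
  next
    case False
    then show ?thesis using p step
      by (intro exI[of _ "p @ [z]"]) (auto simp: successively_append_iff)
  qed
qed

text \<open>A walk avoiding the edge shortens to a path that the edge closes to a cycle. The path
  has at least three vertices, as with two it would use the edge itself.\<close>

lemma acyclic_bridge:
  assumes acyclic: "\<nexists>c. is_cycle F c" and pq: "{p, q} \<in> F" "p \<noteq> q"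
  shows "(p, q) \<notin> {(x, y). {x, y} \<in> F - {{p, q}}}\<^sup>*"
proof
  assume "(p, q) \<in> {(x, y). {x, y} \<in> F - {{p, q}}}\<^sup>*"
  from rtrancl_distinct_path[OF this] obtain l where l: "l \<noteq> []" "hd l = p" "last l = q" "distinct l"
    "successively (\<lambda>a b. {a, b} \<in> F - {{p, q}}) l" by auto
  have step: "{l ! i, l ! Suc i} \<in> F - {{p, q}}" if "Suc i < length l" for i
    using l(5) that by (simp add: successively_conv_nth)
  have ends: "l ! 0 = p" "l ! (length l - 1) = q" using l(1-3) by (auto simp: hd_conv_nth last_conv_nth)
  have "length l \<noteq> 1" using ends pq(2) by auto
  moreover have "length l \<noteq> 2" using ends step[of 0] by auto
  moreover have "length l \<noteq> 0" using l(1) by simp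
  ultimately have len: "length l \<ge> 3" by linarith
  have "{l ! i, l ! (Suc i mod length l)} \<in> F" if "i < length l" for i
  proof (cases "Suc i = length l")
    case True
    then have "l ! i = q" "l ! (Suc i mod length l) = p" using ends by (auto simp flip: True)
    then show ?thesis using pq(1) by (simp add: insert_commute)
  next
    case False
    then show ?thesis using step[of i] that by simp
  qed
  then show False using acyclic l(4) len unfolding is_cycle_def by blast
qed

lemma rtrancl_last_exit:
  assumes "(x, y) \<in> R\<^sup>*" "x \<in> A" "y \<notin> A"
  shows "\<exists>p q. p \<in> A \<and> q \<notin> A \<and> (p, q) \<in> R \<and> (q, y) \<in> (R \<inter> (- A) \<times> (- A))\<^sup>*"
proof -
  have "(x, y) \<in> (R \<inter> (- A) \<times> (- A))\<^sup>* \<or>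
      (\<exists>p q. p \<in> A \<and> q \<notin> A \<and> (p, q) \<in> R \<and> (q, y) \<in> (R \<inter> (- A) \<times> (- A))\<^sup>*)"
    using assms(1)
  proof (induction rule: converse_rtrancl_induct)
    case (step a b)
    show ?case
    proof (cases "(b, y) \<in> (R \<inter> (- A) \<times> (- A))\<^sup>*")
      case True
      then have "b \<notin> A" using assms(3) by (auto elim: converse_rtranclE)
      then show ?thesis using step(1) True by (cases "a \<in> A") (auto intro: converse_rtrancl_into_rtrancl)
    qed (use step in blast)
  qed simp
  then show ?thesis using assms(2,3) by (auto elim: converse_rtranclE)
qed

text \<open>Leave the subtree of \<open>v\<close> for the last time on a walk in the subtree of \<open>u\<close> to a bag containing
  \<open>u\<close> and \<open>w\<close>. If no bag contains all three vertices, the edge used is avoided by a detour through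
  the subtrees of \<open>v\<close> and \<open>w\<close>, so it is not a bridge.\<close>

lemma triangle_in_bag:
  assumes D: "tree_decomposition V E T F bag" and E: "{u, v} \<in> E" "{v, w} \<in> E" "{u, w} \<in> E"
    and V: "u \<in> V" "v \<in> V" "w \<in> V"
  shows "\<exists>t\<in>T. {u, v, w} \<subseteq> bag t"
proof (rule ccontr)
  assume none: "\<not> ?thesis"
  define S where "S x = {t\<in>T. x \<in> bag t}" for x
  define R where "R x = {(a, b). {a, b} \<in> {f\<in>F. f \<subseteq> S x}}" for x
  have conn: "(a, b) \<in> (R x)\<^sup>*" if "x \<in> V" "a \<in> S x" "b \<in> S x" for x a b
    using D that unfolding tree_decomposition_def connected_graph_def S_def R_def by blast
  have "\<exists>t. t \<in> S x \<and> t \<in> S y" if "{x, y} \<in> E" for x y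
    using D that unfolding tree_decomposition_def S_def by fastforce
  then obtain t1 t2 t3 where t: "t1 \<in> S u" "t1 \<in> S v" "t2 \<in> S v" "t2 \<in> S w" "t3 \<in> S u" "t3 \<in> S w"
    using E by meson
  have disj: "x \<notin> S w" if "x \<in> S u" "x \<in> S v" for x
    using none that unfolding S_def by auto
  obtain p q where pq: "p \<in> S v" "q \<notin> S v" "(p, q) \<in> R u"
    and q: "(q, t3) \<in> (R u \<inter> (- S v) \<times> (- S v))\<^sup>*"
    using rtrancl_last_exit[OF conn[OF V(1) t(1,5)] t(2)] disj[OF t(5)] t(6) by metis
  let ?R = "{(x, y). {x, y} \<in> F - {{p, q}}}"
  have p: "p \<in> S u" "{p, q} \<in> F" "p \<noteq> q" using pq unfolding R_def by auto
  have "sym ?R" by (auto simp: sym_def insert_commute)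
  \<comment> \<open>The edge \<open>pq\<close> is missing from all three relations: from the first
    as \<open>p\<close> is in \<open>S v\<close>, from the second as \<open>q\<close> is not, and
    from the third as \<open>p\<close>, being in \<open>S u\<close> and \<open>S v\<close>, is not
    in \<open>S w\<close>.\<close>
  have "R u \<inter> (- S v) \<times> (- S v) \<subseteq> ?R" "R v \<subseteq> ?R" "R w \<subseteq> ?R"
    using pq p disj[of p] unfolding R_def by (auto simp: doubleton_eq_iff)
  note sub = this[THEN rtrancl_mono]
  have "(q, t3) \<in> ?R\<^sup>*" "(p, t2) \<in> ?R\<^sup>*" "(t2, t3) \<in> ?R\<^sup>*"
    using subsetD[OF sub(1) q] subsetD[OF sub(2) conn[OF V(2) pq(1) t(3)]]
      subsetD[OF sub(3) conn[OF V(3) t(4,6)]] by blast+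
  moreover from this have "(t3, q) \<in> ?R\<^sup>*" using sym_rtrancl[OF \<open>sym ?R\<close>] by (meson symD)
  ultimately have "(p, q) \<in> ?R\<^sup>*" by (meson rtrancl_trans)
  moreover have "\<nexists>c. is_cycle F c" using D unfolding tree_decomposition_def tree_graph_def by blast
  ultimately show False using acyclic_bridge[OF _ p(2,3)] by simp
qed

lemma two_tree_treewidth:
  assumes tt: "two_tree V E" and E: "{u, v} \<in> E" "{v, w} \<in> E" "{u, w} \<in> E"
  shows "treewidth V E = 2"
proof -
  have simple: "simple_graph V E" by (rule two_tree_simple[OF tt])
  have V: "u \<in> V" "v \<in> V" "w \<in> V" "finite V" using simple E unfolding simple_graph_def by auto
  have "card {u, v} = 2" "card {v, w} = 2" "card {u, w} = 2" using simple E unfolding simple_graph_def by auto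
  then have c3: "card {u, v, w} = 3" by (auto simp: card_insert_if split: if_splits)
  have ge: "decomposition_width T bag \<ge> 2" if D: "tree_decomposition V E T F bag" for T :: "nat set" and F bag
  proof -
    have T: "finite T" "(\<Union>t\<in>T. bag t) = V"
      using D unfolding tree_decomposition_def tree_graph_def simple_graph_def by blast+
    obtain t where t: "t \<in> T" "{u, v, w} \<subseteq> bag t" using triangle_in_bag[OF D E V(1-3)] by blast
    have "finite (bag t)" using T(2) t(1) V(4) by (metis UN_upper finite_subset)
    then have "3 \<le> card (bag t)" using card_mono[OF _ t(2)] c3 by simp
    also have "\<dots> \<le> Max ((\<lambda>t. card (bag t)) ` T)" using T(1) t(1) by simp
    finally show ?thesis unfolding decomposition_width_def by simp
  qed
  obtain T :: "nat set" and F bag where D: "tree_decomposition V E T F bag" "\<And>t. t \<in> T \<Longrightarrow> card (bag t) \<le> 3"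
    using two_tree_decomposition[OF tt] by blast
  have "finite T" "T \<noteq> {}"
    using D(1) unfolding tree_decomposition_def tree_graph_def simple_graph_def connected_graph_def by blast+
  then have "Max ((\<lambda>t. card (bag t)) ` T) \<le> 3" using D(2) by simp
  then have "decomposition_width T bag = 2" using ge[OF D(1)] unfolding decomposition_width_def by simp
  then show ?thesis unfolding treewidth_def
    by (intro Least_equality) (use D(1) ge in blast)+
qed

subsection \<open>Local queue number\<close>

text \<open>The queues of the layout are stars: each edge is assigned to one of its ends, and the stars at a
  vertex \<open>x\<close> are centred at \<open>x\<close> itself or at one of the two vertices that \<open>x\<close> was stacked onto.\<close>

lemma two_tree_star_assignment:
  assumes "two_tree V E"
  shows "\<exists>c M. (\<forall>e\<in>E. c e \<in> e \<and> (\<forall>x\<in>e. c e \<in> M x)) \<and> (\<forall>x\<in>V. x \<in> M x \<and> finite (M x) \<and> card (M x) \<le> 3)"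
  using assms
proof (induction rule: two_tree.induct)
  case (edge u v)
  show ?case by (rule exI[of _ "\<lambda>_. u"], rule exI[of _ "\<lambda>_. {u, v}"]) (auto simp: card_insert_if)
next
  case (stack V E u v w)
  then obtain c M where c: "\<And>e. e \<in> E \<Longrightarrow> c e \<in> e \<and> (\<forall>x\<in>e. c e \<in> M x)"
    and M: "\<And>x. x \<in> V \<Longrightarrow> x \<in> M x \<and> finite (M x) \<and> card (M x) \<le> 3" by blast
  have simple: "simple_graph V E" using stack.hyps two_tree_simple by blast
  have uv: "u \<in> V" "v \<in> V" using simple stack.hyps unfolding simple_graph_def by auto
  have w: "w \<notin> e" if "e \<in> E" for e using simple that stack.hyps unfolding simple_graph_def by auto
  \<comment> \<open>The new edges are centred at their old ends. As \<open>u\<close> is in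
    \<open>M u\<close> and \<open>v\<close> in \<open>M v\<close>, no set at an old vertex has to
    grow.\<close>
  define c' where "c' e = (if w \<in> e then if u \<in> e then u else v else c e)" for e
  show ?case
    using c M uv w stack.hyps
    by (intro exI[of _ c'] exI[of _ "M(w := {u, v, w})"]) (auto simp: c'_def card_insert_if)
qed

text \<open>Nesting edges are disjoint, so a star is a queue in every vertex order; the order of the
  type is taken.\<close>

lemma two_tree_local_layout:
  fixes V :: "'a :: linorder set"
  assumes tt: "two_tree V E"
  shows "\<exists>r P. queue_layout V E r P \<and> local_layout 3 V P"
proof -
  obtain c M where c: "\<And>e. e \<in> E \<Longrightarrow> c e \<in> e \<and> (\<forall>x\<in>e. c e \<in> M x)"
    and M: "\<And>x. x \<in> V \<Longrightarrow> finite (M x) \<and> card (M x) \<le> 3"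
    using two_tree_star_assignment[OF tt] by blast
  define star where "star s = {e\<in>E. c e = s}" for s
  define r where "r = {(x, y). x \<in> V \<and> y \<in> V \<and> x < y}"
  let ?P = "star ` c ` E"
  have "strict_linear_order_on V r"
    unfolding strict_linear_order_on_def r_def by (auto simp: trans_def irrefl_def total_on_def)
  moreover have "partition_on E ?P"
    by (rule partition_onI) (auto simp: star_def disjnt_def)
  moreover have "is_queue r (star s)" for s
  proof -
    have "\<not> nest r e f" if "e \<in> E" "f \<in> E" "c e = c f" for e f
      using c[OF that(1)] c[OF that(2)] that(3) unfolding nest_def r_def by auto
    then show ?thesis unfolding is_queue_def star_def by auto
  qed
  ultimately have "queue_layout V E r ?P" unfolding queue_layout_def r_def by auto
  moreover have "card {Q\<in>?P. \<exists>e\<in>Q. x \<in> e} \<le> 3" if "x \<in> V" for x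
  proof -
    have "{Q\<in>?P. \<exists>e\<in>Q. x \<in> e} \<subseteq> star ` M x" using c unfolding star_def by fastforce
    then have "card {Q\<in>?P. \<exists>e\<in>Q. x \<in> e} \<le> card (M x)"
      using M[OF that] by (meson card_image_le card_mono finite_imageI le_trans)
    then show ?thesis using M[OF that] by simp
  qed
  ultimately show ?thesis unfolding local_layout_def by blast
qed

section \<open>From 2-local layouts to coloured edges\<close>

lemma rank_strict_mono:
  assumes "strict_linear_order_on V r" "r \<subseteq> V \<times> V" "finite V" "(u, v) \<in> r"
  shows "card {x. (x, u) \<in> r} < card {x. (x, v) \<in> r}"
proof (rule psubset_card_mono)
  show "finite {x. (x, v) \<in> r}" using assms(2,3) by (auto intro: finite_subset)
  show "{x. (x, u) \<in> r} \<subset> {x. (x, v) \<in> r}"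
    using assms(1,4) unfolding strict_linear_order_on_def by (auto dest: transD irreflD)
qed

text \<open>The position of a vertex is its number of predecessors, and the colour of an edge is the
  queue containing it.\<close>

lemma queue_layout_two_local:
  assumes simple: "simple_graph V E" and Q: "queue_layout V E r P" and L: "local_layout 2 V P"
  shows "\<exists>col pos. two_local_layout (\<lambda>u v. {u, v} \<in> E) (col :: 'a \<Rightarrow> 'a \<Rightarrow> 'a set set) pos \<and> inj_on pos (V :: 'a set)"
proof -
  have E: "\<And>e. e \<in> E \<Longrightarrow> e \<subseteq> V \<and> card e = 2" and fin: "finite V"
    using simple unfolding simple_graph_def by auto
  have r: "r \<subseteq> V \<times> V" "strict_linear_order_on V r" and P: "partition_on E P"
    and queue: "\<And>X e f. \<lbrakk>X \<in> P; e \<in> X; f \<in> X\<rbrakk> \<Longrightarrow> \<not> nest r e f"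
    using Q unfolding queue_layout_def is_queue_def by blast+
  define pos where "pos v = int (card {x. (x, v) \<in> r})" for v
  define part where "part e = (THE X. X \<in> P \<and> e \<in> X)" for e
  have part: "part e \<in> P \<and> e \<in> part e" if "e \<in> E" for e
  proof -
    have "\<exists>!X. X \<in> P \<and> e \<in> X"
      using that P unfolding partition_on_def disjoint_def by blast
    then show ?thesis unfolding part_def by (rule theI')
  qed
  have mono: "pos u < pos v" if "(u, v) \<in> r" for u v
    unfolding pos_def using rank_strict_mono[OF r(2,1) fin that] by simp
  have total: "(u, v) \<in> r" if "pos u < pos v" "u \<in> V" "v \<in> V" for u v
    using r(2) that mono[of v u] unfolding strict_linear_order_on_def total_on_def by force
  have inj: "inj_on pos V"
    using r(2) mono unfolding strict_linear_order_on_def total_on_def inj_on_def by (metis less_irrefl)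
  have "two_local_layout (\<lambda>u v. {u, v} \<in> E) (\<lambda>u v. part {u, v}) pos"
  proof
    show "inj_on pos {v. \<exists>w. {v, w} \<in> E}" by (rule inj_on_subset[OF inj]) (use E in auto)
    show "part {u, v} \<noteq> part {x, y}"
      if "{u, v} \<in> E" "{x, y} \<in> E" "pos u < pos x" "pos x < pos y" "pos y < pos v" for u v x y
    proof
      assume "part {u, v} = part {x, y}"
      then have "\<not> nest r {u, v} {x, y}" using queue part that(1,2) by metis
      moreover have "(u, x) \<in> r" "(x, y) \<in> r" "(y, v) \<in> r"
        using total that E[OF that(1)] E[OF that(2)] by auto
      ultimately show False unfolding nest_def by blast
    qed
    show "part {v, z} \<in> {part {v, x}, part {v, y}}"
      if e: "{v, x} \<in> E" "{v, y} \<in> E" "{v, z} \<in> E" and neq: "part {v, x} \<noteq> part {v, y}" for v x y z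
    proof (rule ccontr)
      let ?I = "{X\<in>P. \<exists>e\<in>X. v \<in> e}"
      assume "\<not> ?thesis"
      then have three: "card {part {v, x}, part {v, y}, part {v, z}} = 3"
        using neq by (simp add: card_insert_if eq_commute)
      have sub: "{part {v, x}, part {v, y}, part {v, z}} \<subseteq> ?I"
        using part[OF e(1)] part[OF e(2)] part[OF e(3)] by blast
      \<comment> \<open>Without finiteness the cardinality of \<open>?I\<close> could be 0 by
        default and would bound nothing.\<close>
      have "finite ?I"
      proof -
        have "finite E" using E fin by (auto intro: finite_subset[of E "Pow V"])
        then have "finite P" using P by (rule finite_elements)
        then show ?thesis by simp
      qed
      from card_mono[OF this sub] have "3 \<le> card ?I" unfolding three .
      moreover have "v \<in> V" using E[OF e(1)] by simp
      then have "card ?I \<le> 2" using L unfolding local_layout_def by (rule bspec[rotated])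
      ultimately show False by simp
    qed
    show "\<not> {u, u} \<in> E" for u using E by fastforce
  qed (simp_all add: insert_commute)
  then show ?thesis using inj by blast
qed

lemma rich_two_tree_not_two_local:
  fixes E :: "'a set set"
  assumes simple: "simple_graph V E" and rich: "rich (\<lambda>x y. {x, y} \<in> E) 37 12 u v"
    and "queue_layout V E r P" "local_layout l V P"
  shows "3 \<le> l"
proof (rule ccontr)
  assume "\<not> 3 \<le> l"
  then have "local_layout 2 V P"
    using assms(4) unfolding local_layout_def by fastforce
  then obtain col :: "'a \<Rightarrow> 'a \<Rightarrow> 'a set set" and pos where
    L: "two_local_layout (\<lambda>u v. {u, v} \<in> E) col pos" and inj: "inj_on pos V"
    using queue_layout_two_local[OF simple assms(3)] by blast
  have "{u, v} \<subseteq> V" "card {u, v} = 2"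
    using simple rich_adj[OF rich] unfolding simple_graph_def by auto
  then have "pos u \<noteq> pos v" using inj unfolding inj_on_def by (cases "u = v") auto
  then show False using two_local_layout.not_rich[OF L] rich by blast
qed

theorem theorem4:
  shows "\<exists>(V :: nat set) (E :: nat set set).
    simple_graph V E \<and> treewidth V E = 2 \<and> local_queue_number V E = 3"
proof -
  have "two_tree {0, 1} {{0, 1 :: nat}}" by (rule two_tree.edge) simp
  from two_tree_rich_extension[OF this, of 0 1 37 12] obtain V E where
    tt: "two_tree V E" and rich: "rich (\<lambda>x y. {x, y} \<in> E) 37 12 0 (1 :: nat)" by auto
  have "rich (\<lambda>x y. {x, y} \<in> E) 37 (Suc 11) 0 1" using rich by simp
  then obtain W where "{0, 1} \<in> E" "card W = 37"
    "\<And>w. w \<in> W \<Longrightarrow> rich (\<lambda>x y. {x, y} \<in> E) 37 11 0 w"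
    "\<And>w. w \<in> W \<Longrightarrow> rich (\<lambda>x y. {x, y} \<in> E) 37 11 1 w"
    by (rule rich_SucE) (rule that)
  \<comment> \<open>Any stacked vertex closes a triangle, as the lower bound on the treewidth
    requires.\<close>
  moreover from this obtain w where "w \<in> W" by fastforce
  ultimately have "{0, 1} \<in> E" "{1, w} \<in> E" "{0, w} \<in> E"
    using rich_adj[of "\<lambda>x y. {x, y} \<in> E"] by blast+
  then have "treewidth V E = 2" by (rule two_tree_treewidth[OF tt])
  moreover have "simple_graph V E" by (rule two_tree_simple[OF tt])
  moreover from this have "local_queue_number V E = 3"
    unfolding local_queue_number_def
    using two_tree_local_layout[OF tt] rich_two_tree_not_two_local[OF _ rich]
    by (intro Least_equality) blast+
  ultimately show ?thesis by blast
qed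

end
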